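(* Consider a point $\bar x\in\mathbb{R}^n$ along with a mapping $f:\mathbb{R}^n\to\mathbb{R}^m$ which is both defined and continuous in a vicinity of $\bar x$ and Fréchet differentiable at $\bar x$. If $f'(\bar x)$ is surjective, then $n\ge m$ and $\mathrm{lopen}\,f(\bar x)\ge\mathrm{sur}\,f'(\bar x)>0$.
   Context: $\mathbb{R}^n$, $\mathbb{R}^m$ carry Euclidean norms; $\mathbb{B}[u,r]$ is the closed ball. "In a vicinity of $\bar x$" means on some neighborhood of $\bar x$. $\mathrm{lopen}\,f(\bar x)$ is the supremum of all $c>0$ for which there is $\varepsilon>0$ such that $\mathbb{B}[f(\bar x),ct]\subset f(\mathbb{B}[\bar x,t])$ for each $t\in(0,\varepsilon)$ ($\sup\emptyset=0$). For a continuous linear operator $A$ the modulus of surjection is $\mathrm{sur}\,A=\sup\{\varrho>0: A(\mathbb{B}[0,1])\supset\mathbb{B}[0,\varrho]\}$; for a surjective matrix $A\in\mathbb{R}^{m\times n}$ this is its least singular value. *)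

theory Defs
  imports "HOL-Analysis.Analysis"
begin

text \<open>
  Both moduli are suprema of sets of positive reals that may be empty or unbounded.
  They take values in \<^typ>\<open>ennreal\<close>, where the supremum of the empty set is \<open>0\<close>.

  A mapping defined only near \<open>x\<close> is represented by a total function with arbitrary values
  elsewhere. These values do not influence \<open>lopen f x\<close>, because \<open>\<epsilon>\<close> may be taken
  arbitrarily small.
\<close>

definition lopen :: "('a::metric_space \<Rightarrow> 'b::metric_space) \<Rightarrow> 'a \<Rightarrow> ennreal" where
  "lopen f x = Sup {ennreal c | c. c > 0 \<and>
     (\<exists>\<epsilon>>0. \<forall>t. 0 < t \<and> t < \<epsilon> \<longrightarrow> cball (f x) (c * t) \<subseteq> f ` cball x t)}"

definition sur :: "('a::real_normed_vector \<Rightarrow> 'b::real_normed_vector) \<Rightarrow> ennreal" where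
  "sur A = Sup {ennreal \<rho> | \<rho>. \<rho> > 0 \<and> cball 0 \<rho> \<subseteq> A ` cball 0 1}"

end

theory Submission
  imports Defs
begin

text \<open>
  The idea is to turn an inclusion \<open>cball 0 \<rho> \<subseteq> f' ` cball 0 1\<close> into a \<^emph>\<open>linear\<close> right inverse
  \<open>B\<close> of \<open>f'\<close> with \<open>norm (B y) \<le> norm y / \<rho>\<close>. The inclusion by itself only says that every
  \<open>y\<close> has \<^emph>\<open>some\<close> preimage of norm at most \<open>norm y / \<rho>\<close>; but the preimage of
  least norm is the one orthogonal to the kernel, and this one depends linearly on \<open>y\<close>. It is the
  Moore-Penrose inverse \<open>f'\<^sup>* (f' f'\<^sup>*)\<^sup>-\<^sup>1\<close> (lemmas \<open>surj_minimal_norm_right_inverse\<close>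
  and \<open>minimal_norm_right_inverse_bound\<close>).

  With \<open>B\<close> at hand, the map \<open>z \<mapsto> f (x + B z)\<close> goes from the target space to itself and is a
  perturbation of the translation \<open>z \<mapsto> f x + z\<close>: on the ball of radius \<open>\<rho> t\<close> one has
  \<open>norm (B z) \<le> t\<close>, and differentiability at \<open>x\<close> makes the error at most \<open>(\<rho> - c) t\<close>
  for small \<open>t\<close>, whenever \<open>c < \<rho>\<close>. Since \<open>f\<close> is differentiable at the single
  point \<open>x\<close> only, the error need not be a contraction, so no iteration is available;
  continuity and Brouwer's fixed point theorem give that the perturbed map still covers the ball of
  radius \<open>c t\<close> around \<open>f x\<close> (lemma \<open>has_derivative_covers_ball\<close>). Letting \<open>c\<close> tend to
  \<open>\<rho>\<close> yields the comparison of the two moduli.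
\<close>

text \<open>
  The map \<open>A A\<^sup>*\<close> is injective because \<open>A A\<^sup>* y = 0\<close> forces \<open>A\<^sup>* y = 0\<close>, which says that \<open>y\<close> is
  orthogonal to the range of \<open>A\<close>. Composing its inverse with \<open>A\<^sup>*\<close> gives a right inverse
  with values in the range of \<open>A\<^sup>*\<close>, which is orthogonal to the kernel.
\<close>

lemma surj_minimal_norm_right_inverse:
  fixes A :: "'a::euclidean_space \<Rightarrow> 'b::euclidean_space"
  assumes lin: "linear A" and "surj A"
  obtains B where "linear B" and "\<And>y. A (B y) = y"
    and "\<And>y k. A k = 0 \<Longrightarrow> B y \<bullet> k = 0"
proof -
  define S where "S = A \<circ> adjoint A"
  have linS: "linear S"
    unfolding S_def by (intro linear_compose adjoint_linear lin)
  have "y = 0" if "S y = 0" for y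
  proof -
    have "adjoint A y \<bullet> adjoint A y = 0"
      using that by (simp add: S_def adjoint_works[OF lin])
    then have "adjoint A y = 0" by simp
    then have "A u \<bullet> y = 0" for u
      by (metis adjoint_works[OF lin] inner_zero_right)
    then have "y \<bullet> y = 0"
      using \<open>surj A\<close> by (metis surjD)
    then show "y = 0" by simp
  qed
  then have "inj S"
    using linear_injective_0[OF linS] by blast
  then obtain T where T: "linear T" "\<And>y. S (T y) = y"
    using linear_injective_isomorphism[OF linS] by blast
  show thesis
  proof
    show "linear (adjoint A \<circ> T)"
      by (intro linear_compose adjoint_linear lin T)
    show "A ((adjoint A \<circ> T) y) = y" for y
      using T(2)[of y] by (simp add: S_def)
    show "(adjoint A \<circ> T) y \<bullet> k = 0" if "A k = 0" for y k
      using that by (simp add: adjoint_clauses[OF lin])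
  qed
qed

text \<open>
  Any preimage \<open>u\<close> of \<open>y\<close> differs from \<open>B y\<close> by an element of the kernel, so
  Pythagoras gives \<open>norm (B y) \<le> norm u\<close>.
\<close>

lemma minimal_norm_right_inverse_bound:
  fixes A :: "'a::real_inner \<Rightarrow> 'b::real_normed_vector"
  assumes linA: "linear A" and linB: "linear B"
    and inv: "\<And>y. A (B y) = y"
    and orth: "\<And>y k. A k = 0 \<Longrightarrow> B y \<bullet> k = 0"
    and "\<rho> > 0" and sub: "cball 0 \<rho> \<subseteq> A ` cball 0 1"
  shows "norm (B y) \<le> norm y / \<rho>"
proof (cases "y = 0")
  case True
  then show ?thesis by (simp add: linear_0[OF linB])
next
  case False
  define s where "s = \<rho> / norm y"
  have "s > 0" using False \<open>\<rho> > 0\<close> by (simp add: s_def)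
  have "s *\<^sub>R y \<in> cball 0 \<rho>"
    using False \<open>\<rho> > 0\<close> by (simp add: s_def)
  then obtain u where u: "norm u \<le> 1" "A u = s *\<^sub>R y"
    using sub by (metis imageE mem_cball_0 subsetD)
  define k where "k = u - B (s *\<^sub>R y)"
  have "A k = 0"
    by (simp add: k_def linear_diff[OF linA] inv u)
  then have "(norm (B (s *\<^sub>R y) + k))\<^sup>2 = (norm (B (s *\<^sub>R y)))\<^sup>2 + (norm k)\<^sup>2"
    by (intro norm_add_Pythagorean) (simp add: orth orthogonal_def)
  then have "(norm (B (s *\<^sub>R y)))\<^sup>2 \<le> (norm u)\<^sup>2"
    by (simp add: k_def)
  then have "norm (B (s *\<^sub>R y)) \<le> 1"
    using u(1) by (meson norm_ge_zero order_trans power2_le_imp_le)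
  then have "s * norm (B y) \<le> 1"
    using \<open>s > 0\<close> by (simp add: linear_scale[OF linB])
  then show ?thesis
    using False \<open>\<rho> > 0\<close> by (simp add: s_def field_simps)
qed

lemma sur_pos:
  fixes A :: "'a::euclidean_space \<Rightarrow> 'b::euclidean_space"
  assumes "linear A" and "surj A"
  shows "sur A > 0"
proof -
  obtain B where B: "linear B" "\<And>y. A (B y) = y"
    using surj_minimal_norm_right_inverse[OF assms] by metis
  obtain K where K: "K > 0" "\<And>y. norm (B y) \<le> K * norm y"
    using linear_bounded_pos[OF B(1)] by blast
  have "cball 0 (1 / K) \<subseteq> A ` cball 0 1"
  proof
    fix y :: 'b assume "y \<in> cball 0 (1 / K)"
    then have "K * norm y \<le> 1" using K(1) by (simp add: field_simps)
    then have "B y \<in> cball 0 1" using K(2)[of y] by simp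
    then show "y \<in> A ` cball 0 1" using B(2) by (metis imageI)
  qed
  moreover have "1 / K > 0" using K(1) by simp
  ultimately have "ennreal (1 / K) \<le> sur A"
    unfolding sur_def by (intro Sup_upper) blast
  moreover have "ennreal (1 / K) > 0" using K(1) by simp
  ultimately show ?thesis by (rule less_le_trans[rotated])
qed

text \<open>
  Solving \<open>f (x + B z) = w\<close> amounts to finding a fixed point of
  \<open>z \<mapsto> w - (f (x + B z) - z)\<close>. The radii \<open>c t\<close> of the admissible targets and
  \<open>(\<rho> - c) t\<close> of the error add up to exactly \<open>\<rho> t\<close>, so the ball of radius
  \<open>\<rho> t\<close> is mapped to itself.
\<close>

lemma has_derivative_covers_ball:
  fixes f :: "'a::euclidean_space \<Rightarrow> 'b::euclidean_space"
  assumes "open U" and "x \<in> U" and cont: "continuous_on U f"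
    and der: "(f has_derivative A) (at x)" and "surj A"
    and "cball 0 \<rho> \<subseteq> A ` cball 0 1" and "0 < c" and "c < \<rho>"
  shows "\<exists>\<epsilon>>0. \<forall>t. 0 < t \<and> t < \<epsilon> \<longrightarrow> cball (f x) (c * t) \<subseteq> f ` cball x t"
proof -
  have linA: "linear A" using der by (rule has_derivative_linear)
  have "\<rho> > 0" using assms by simp
  obtain B where B: "linear B" "\<And>y. A (B y) = y"
    "\<And>y k. A k = 0 \<Longrightarrow> B y \<bullet> k = 0"
    using surj_minimal_norm_right_inverse[OF linA \<open>surj A\<close>] by metis
  have bound: "norm (B y) \<le> norm y / \<rho>" for y
    using minimal_norm_right_inverse_bound[OF linA B \<open>\<rho> > 0\<close>] assms by blast
  obtain d where d: "d > 0"
    "\<And>y. norm (y - x) < d \<Longrightarrow> norm (f y - f x - A (y - x)) \<le> (\<rho> - c) * norm (y - x)"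
    using der \<open>c < \<rho>\<close> unfolding has_derivative_at_alt by (metis diff_gt_0_iff_gt)
  obtain r where r: "r > 0" "ball x r \<subseteq> U"
    using \<open>open U\<close> \<open>x \<in> U\<close> openE by blast
  have "cball (f x) (c * t) \<subseteq> f ` cball x t" if t: "0 < t" "t < min d r" for t
  proof
    fix w assume w: "w \<in> cball (f x) (c * t)"
    define g where "g z = f (x + B z) - f x" for z
    have Bz: "norm (B z) \<le> t" if "z \<in> cball 0 (\<rho> * t)" for z
    proof -
      have "norm z / \<rho> \<le> t" using that \<open>\<rho> > 0\<close> by (simp add: field_simps)
      then show ?thesis using bound[of z] by linarith
    qed
    have into_U: "x + B z \<in> U" if "z \<in> cball 0 (\<rho> * t)" for z
      using Bz[OF that] t r(2) by (auto simp: dist_norm)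
    have "continuous_on (cball 0 (\<rho> * t)) g"
      unfolding g_def
      by (intro continuous_intros continuous_on_compose2[OF cont]
          linear_continuous_on linear_conv_bounded_linear[THEN iffD1] B)
        (use into_U in auto)
    moreover have "(w - f x) + (z - g z) \<in> cball 0 (\<rho> * t)"
      if z: "z \<in> cball 0 (\<rho> * t)" for z
    proof -
      have "norm (g z - z) \<le> (\<rho> - c) * norm (B z)"
        using d(2)[of "x + B z"] Bz[OF z] t by (simp add: g_def B(2))
      also have "\<dots> \<le> (\<rho> - c) * t"
        using Bz[OF z] \<open>c < \<rho>\<close> by (intro mult_left_mono) auto
      finally have "norm (z - g z) \<le> (\<rho> - c) * t"
        by (simp add: norm_minus_commute)
      moreover have "norm (w - f x) \<le> c * t"
        using w by (simp add: dist_norm norm_minus_commute)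
      ultimately show ?thesis
        using norm_triangle_ineq[of "w - f x" "z - g z"] by (simp add: algebra_simps)
    qed
    ultimately obtain z where z: "z \<in> cball 0 (\<rho> * t)" "g z = w - f x"
      using brouwer_surjective_cball[of 0 "\<rho> * t" g "w - f x" "{w - f x}"] t \<open>\<rho> > 0\<close>
      by auto
    then have "f (x + B z) = w" by (simp add: g_def)
    moreover have "x + B z \<in> cball x t" using Bz[OF z(1)] by (simp add: dist_norm)
    ultimately show "w \<in> f ` cball x t" by blast
  qed
  moreover have "min d r > 0" using d r by simp
  ultimately show ?thesis by blast
qed

lemma sur_le_lopen:
  fixes f :: "'a::euclidean_space \<Rightarrow> 'b::euclidean_space"
  assumes "open U" and "x \<in> U" and "continuous_on U f"
    and "(f has_derivative A) (at x)" and "surj A"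
  shows "sur A \<le> lopen f x"
  unfolding sur_def
proof (rule Sup_least, clarify)
  fix \<rho> :: real assume \<rho>: "\<rho> > 0" "cball 0 \<rho> \<subseteq> A ` cball 0 1"
  have le: "ennreal c \<le> lopen f x" if "0 < c" "c < \<rho>" for c
    unfolding lopen_def
    using has_derivative_covers_ball[OF assms \<rho>(2) that] that
    by (intro Sup_upper) blast
  show "ennreal \<rho> \<le> lopen f x"
  proof (rule dense_le)
    fix y assume y: "y < ennreal \<rho>"
    then obtain c where c: "y = ennreal c" "0 \<le> c"
      by (cases y) auto
    then have "c < \<rho>" using y by (simp add: ennreal_less_iff)
    \<comment> \<open>The midpoint is used since \<open>c\<close> may be zero.\<close>
    have "y \<le> ennreal ((c + \<rho>) / 2)"
      using c \<open>c < \<rho>\<close> by (simp add: ennreal_leI)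
    also have "\<dots> \<le> lopen f x"
      using c \<open>c < \<rho>\<close> by (intro le) auto
    finally show "y \<le> lopen f x" .
  qed
qed

theorem corollary3p5:
  fixes f :: "real ^ 'n \<Rightarrow> real ^ 'm" and f' :: "real ^ 'n \<Rightarrow> real ^ 'm" and x :: "real ^ 'n"
  assumes "open U" and "x \<in> U" and "continuous_on U f"
    and "(f has_derivative f') (at x)"
    and "surj f'"
  shows "CARD('n) \<ge> CARD('m) \<and> lopen f x \<ge> sur f' \<and> sur f' > 0"
proof (intro conjI)
  have lin: "linear f'"
    using assms(4) by (rule has_derivative_linear)
  have "dim (range f') \<le> dim (UNIV :: (real ^ 'n) set)"
    by (rule dim_image_le[OF lin])
  then show "CARD('m) \<le> CARD('n)"
    using \<open>surj f'\<close> by simp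
  show "sur f' \<le> lopen f x"
    using assms by (rule sur_le_lopen)
  show "0 < sur f'"
    using lin \<open>surj f'\<close> by (rule sur_pos)
qed

end
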